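(* Let $n\ge 0$ and let $\mathcal{A}_n$ be the $2^n$-dimensional Cayley--Dickson algebra over $\mathbb{R}$. Then the radius $r(a)$ of every element $a=(\alpha_1,\ldots,\alpha_{2^n})\in\mathcal{A}_n$ is its Euclidean norm, i.e., $$r(a)=|a|=\sqrt{\alpha_1^2+\cdots+\alpha_{2^n}^2},\qquad a\in\mathcal{A}_n.$$
   Context: Cayley--Dickson algebras: $\mathcal{A}_0=\mathbb{R}$ with conjugation $a^\ast=a$. For $n\ge1$, $\mathcal{A}_n=\{(a,b): a,b\in\mathcal{A}_{n-1}\}$ with componentwise addition and real scalar multiplication, conjugation $(a,b)^\ast=(a^\ast,-b)$, and multiplication $(a,b)(c,d)=(ac-d^\ast b,\ da+bc^\ast)$. By flattening nested pairs, elements of $\mathcal{A}_n$ are written $a=(\alpha_1,\ldots,\alpha_{2^n})$ with $\alpha_j\in\mathbb{R}$; the unit element is $\mathbf{1}_n=(1,0,\ldots,0)$. An algebra is power-associative if the subalgebra generated by any one element is associative, so that powers of an element are unambiguously defined. It is known that all $\mathcal{A}_n$ are power-associative. Radius: let $\mathcal{A}$ be a finite-dimensional power-associative algebra over $\mathbb{R}$ or $\mathbb{C}$. A minimal polynomial of $a\in\mathcal{A}$ is a monic polynomial of lowest positive degree, with coefficients in the base field, that annihilates $a$; it is known that every $a$ has a unique minimal polynomial $q_a$ and that $q_a$ divides every polynomial annihilating $a$. The radius of $a$ is $r(a)=\max\{|\lambda| : \lambda\in\mathbb{C},\ \lambda \text{ is a root of } q_a\}$. *)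

theory Defs
  imports "HOL-Computational_Algebra.Polynomial" "HOL-Algebra.Module" Complex_Main
begin

text \<open>
  All Cayley-Dickson algebras live in one type of nested pairs over the reals; the elements of the
  n-th algebra are the complete nestings of depth n.  On arguments of different shapes the binary
  operations below are unspecified.
\<close>

datatype cd = Scalar real | Pair cd cd

primrec cd_carrier :: "nat \<Rightarrow> cd set" where
  "cd_carrier 0 = range Scalar"
| "cd_carrier (Suc n) = {Pair a b | a b. a \<in> cd_carrier n \<and> b \<in> cd_carrier n}"

primrec cd_zero :: "nat \<Rightarrow> cd" where
  "cd_zero 0 = Scalar 0"
| "cd_zero (Suc n) = Pair (cd_zero n) (cd_zero n)"

primrec cd_one :: "nat \<Rightarrow> cd" where
  "cd_one 0 = Scalar 1"
| "cd_one (Suc n) = Pair (cd_one n) (cd_zero n)"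

fun cd_add :: "cd \<Rightarrow> cd \<Rightarrow> cd" where
  "cd_add (Scalar x) (Scalar y) = Scalar (x + y)"
| "cd_add (Pair a b) (Pair c d) = Pair (cd_add a c) (cd_add b d)"

primrec cd_scale :: "real \<Rightarrow> cd \<Rightarrow> cd" where
  "cd_scale r (Scalar x) = Scalar (r * x)"
| "cd_scale r (Pair a b) = Pair (cd_scale r a) (cd_scale r b)"

definition cd_uminus :: "cd \<Rightarrow> cd" where
  "cd_uminus a = cd_scale (- 1) a"

definition cd_minus :: "cd \<Rightarrow> cd \<Rightarrow> cd" where
  "cd_minus a b = cd_add a (cd_uminus b)"

primrec cd_conj :: "cd \<Rightarrow> cd" where
  "cd_conj (Scalar x) = Scalar x"
| "cd_conj (Pair a b) = Pair (cd_conj a) (cd_uminus b)"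

lemma size_cd_scale [simp]: "size (cd_scale r a) = size a"
  by (induction a) auto

lemma size_cd_conj [simp]: "size (cd_conj a) = size a"
  by (induction a) (auto simp: cd_uminus_def)

function (sequential) cd_mult :: "cd \<Rightarrow> cd \<Rightarrow> cd" where
  "cd_mult (Scalar x) (Scalar y) = Scalar (x * y)"
| "cd_mult (Pair a b) (Pair c d) =
     Pair (cd_minus (cd_mult a c) (cd_mult (cd_conj d) b))
          (cd_add (cd_mult d a) (cd_mult b (cd_conj c)))"
  by pat_completeness auto
termination
  by (relation "measure (\<lambda>(x, y). size x + size y)") auto

text \<open>
  The record type of modules also carries a multiplication and a unit, so it serves as the
  signature of a real algebra, which need not be associative or commutative.
\<close>

definition cayley_dickson :: "nat \<Rightarrow> (real, cd) module" where
  "cayley_dickson n =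
     \<lparr>carrier = cd_carrier n, mult = cd_mult, one = cd_one n,
      zero = cd_zero n, add = cd_add, smult = cd_scale\<rparr>"

primrec cd_coords :: "cd \<Rightarrow> real list" where
  "cd_coords (Scalar x) = [x]"
| "cd_coords (Pair a b) = cd_coords a @ cd_coords b"

text \<open>
  In the following definitions \<open>A\<close> is meant to be a unital finite-dimensional power-associative
  real algebra.  The powers are bracketed to the left, which is immaterial by
  power-associativity; the constant coefficient of a polynomial multiplies the unit of \<open>A\<close>.
\<close>

definition alg_poly :: "(real, 'a, 'm) module_scheme \<Rightarrow> real poly \<Rightarrow> 'a \<Rightarrow> 'a" where
  "alg_poly A p a = (\<Oplus>\<^bsub>A\<^esub>i\<in>{..degree p}. coeff p i \<odot>\<^bsub>A\<^esub> (a [^]\<^bsub>A\<^esub> i))"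

definition monic_annihilator :: "(real, 'a, 'm) module_scheme \<Rightarrow> 'a \<Rightarrow> real poly \<Rightarrow> bool" where
  "monic_annihilator A a p \<longleftrightarrow>
     lead_coeff p = 1 \<and> 0 < degree p \<and> alg_poly A p a = \<zero>\<^bsub>A\<^esub>"

definition is_minimal_poly :: "(real, 'a, 'm) module_scheme \<Rightarrow> 'a \<Rightarrow> real poly \<Rightarrow> bool" where
  "is_minimal_poly A a q \<longleftrightarrow>
     monic_annihilator A a q \<and> (\<forall>p. monic_annihilator A a p \<longrightarrow> degree q \<le> degree p)"

definition minimal_poly :: "(real, 'a, 'm) module_scheme \<Rightarrow> 'a \<Rightarrow> real poly" where
  "minimal_poly A a = (THE q. is_minimal_poly A a q)"

definition radius :: "(real, 'a, 'm) module_scheme \<Rightarrow> 'a \<Rightarrow> real" where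
  "radius A a =
     Max {cmod z | z. poly (map_poly complex_of_real (minimal_poly A a)) z = 0}"

end

theory Submission imports Defs begin

text \<open>
  Every element satisfies \<open>a\<^sup>2 = 2 Re(a) a - |a|\<^sup>2 1\<close>.  If \<open>a\<close> is a real multiple \<open>r 1\<close> of the unit,
  its minimal polynomial is \<open>X - r\<close>.  Otherwise \<open>1\<close> and \<open>a\<close> are linearly independent, so the minimal
  polynomial is \<open>X\<^sup>2 - 2 Re(a) X + |a|\<^sup>2\<close>; since \<open>Re(a)\<^sup>2 \<le> |a|\<^sup>2\<close>, both of its complex roots have
  modulus \<open>|a|\<close>.
\<close>

primrec cd_re :: "cd \<Rightarrow> real" where
  "cd_re (Scalar x) = x"
| "cd_re (Pair a b) = cd_re a"

primrec cd_normsq :: "cd \<Rightarrow> real" where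
  "cd_normsq (Scalar x) = x\<^sup>2"
| "cd_normsq (Pair a b) = cd_normsq a + cd_normsq b"

section \<open>Closure and componentwise linear structure\<close>

lemma cd_zero_closed [simp]: "cd_zero n \<in> cd_carrier n"
  by (induction n) auto

lemma cd_one_closed [simp]: "cd_one n \<in> cd_carrier n"
  by (induction n) auto

lemma cd_add_closed [simp]:
  "a \<in> cd_carrier n \<Longrightarrow> b \<in> cd_carrier n \<Longrightarrow> cd_add a b \<in> cd_carrier n"
  by (induction n arbitrary: a b) auto

lemma cd_scale_closed [simp]: "a \<in> cd_carrier n \<Longrightarrow> cd_scale r a \<in> cd_carrier n"
  by (induction n arbitrary: a) auto

lemma cd_uminus_closed [simp]: "a \<in> cd_carrier n \<Longrightarrow> cd_uminus a \<in> cd_carrier n"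
  by (simp add: cd_uminus_def)

lemma cd_minus_closed [simp]:
  "a \<in> cd_carrier n \<Longrightarrow> b \<in> cd_carrier n \<Longrightarrow> cd_minus a b \<in> cd_carrier n"
  by (simp add: cd_minus_def)

lemma cd_conj_closed [simp]: "a \<in> cd_carrier n \<Longrightarrow> cd_conj a \<in> cd_carrier n"
  by (induction n arbitrary: a) auto

lemma cd_mult_closed [simp]:
  "a \<in> cd_carrier n \<Longrightarrow> b \<in> cd_carrier n \<Longrightarrow> cd_mult a b \<in> cd_carrier n"
  by (induction n arbitrary: a b) auto

lemma cd_add_assoc:
  "a \<in> cd_carrier n \<Longrightarrow> b \<in> cd_carrier n \<Longrightarrow> c \<in> cd_carrier n \<Longrightarrow>
   cd_add (cd_add a b) c = cd_add a (cd_add b c)"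
  by (induction n arbitrary: a b c) auto

lemma cd_add_commute:
  "a \<in> cd_carrier n \<Longrightarrow> b \<in> cd_carrier n \<Longrightarrow> cd_add a b = cd_add b a"
  by (induction n arbitrary: a b) auto

lemma cd_add_zero [simp]: "a \<in> cd_carrier n \<Longrightarrow> cd_add a (cd_zero n) = a"
  by (induction n arbitrary: a) auto

lemma cd_zero_add [simp]: "a \<in> cd_carrier n \<Longrightarrow> cd_add (cd_zero n) a = a"
  by (induction n arbitrary: a) auto

lemma cd_add_uminus: "a \<in> cd_carrier n \<Longrightarrow> cd_add a (cd_uminus a) = cd_zero n"
  by (induction n arbitrary: a) (auto simp: cd_uminus_def)

lemma cd_uminus_add: "a \<in> cd_carrier n \<Longrightarrow> cd_add (cd_uminus a) a = cd_zero n"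
  by (induction n arbitrary: a) (auto simp: cd_uminus_def)

lemma cd_scale_scale [simp]: "cd_scale r (cd_scale s a) = cd_scale (r * s) a"
  by (induction a) auto

lemma cd_scale_1 [simp]: "cd_scale 1 a = a"
  by (induction a) auto

lemma cd_uminus_uminus [simp]: "cd_uminus (cd_uminus a) = a"
  by (simp add: cd_uminus_def)

lemma cd_scale_zero [simp]: "cd_scale r (cd_zero n) = cd_zero n"
  by (induction n) auto

lemma cd_uminus_zero [simp]: "cd_uminus (cd_zero n) = cd_zero n"
  by (simp add: cd_uminus_def)

lemma cd_uminus_distrib_add:
  "a \<in> cd_carrier n \<Longrightarrow> b \<in> cd_carrier n \<Longrightarrow>
   cd_uminus (cd_add a b) = cd_add (cd_uminus a) (cd_uminus b)"
  by (induction n arbitrary: a b) (auto simp: cd_uminus_def)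

section \<open>Conjugation; zero, unit and signs in products\<close>

lemma cd_conj_conj [simp]: "cd_conj (cd_conj a) = a"
  by (induction a) auto

lemma cd_conj_uminus [simp]: "cd_conj (cd_uminus a) = cd_uminus (cd_conj a)"
  by (induction a) (auto simp: cd_uminus_def)

lemma cd_conj_zero [simp]: "cd_conj (cd_zero n) = cd_zero n"
  by (induction n) auto

lemma cd_conj_one [simp]: "cd_conj (cd_one n) = cd_one n"
  by (induction n) auto

text \<open>A product of pairs multiplies components in both orders, as in
  \<open>cd_mult a c\<close> next to \<open>cd_mult d a\<close>, so the left and right laws go
  through one induction. The same form serves the unit and negation.\<close>

lemma cd_mult_zero:
  "a \<in> cd_carrier n \<Longrightarrow> cd_mult (cd_zero n) a = cd_zero n \<and> cd_mult a (cd_zero n) = cd_zero n"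
  by (induction n arbitrary: a) (auto simp: cd_minus_def)

lemma cd_mult_one:
  "a \<in> cd_carrier n \<Longrightarrow> cd_mult (cd_one n) a = a \<and> cd_mult a (cd_one n) = a"
  by (induction n arbitrary: a) (auto simp: cd_minus_def cd_mult_zero)

lemma cd_mult_uminus:
  "a \<in> cd_carrier n \<Longrightarrow> b \<in> cd_carrier n \<Longrightarrow>
   cd_mult (cd_uminus a) b = cd_uminus (cd_mult a b) \<and>
   cd_mult a (cd_uminus b) = cd_uminus (cd_mult a b)"
proof (induction n arbitrary: a b)
  case 0
  then show ?case by (auto simp: cd_uminus_def)
next
  case (Suc n)
  \<comment> \<open>Pushes negation into pairs while keeping \<open>cd_uminus\<close> folded on the
    components, the form in which the induction hypothesis is stated.\<close>
  have pair: "cd_uminus (Pair x y) = Pair (cd_uminus x) (cd_uminus y)" for x y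
    by (simp add: cd_uminus_def)
  from Suc show ?case
    by (auto simp: pair cd_minus_def cd_uminus_distrib_add[of _ n])
qed

section \<open>The quadratic identity satisfied by every element\<close>

lemma cd_add_add_eq:
  "a \<in> cd_carrier n \<Longrightarrow> b \<in> cd_carrier n \<Longrightarrow> c \<in> cd_carrier n \<Longrightarrow> d \<in> cd_carrier n \<Longrightarrow>
   cd_add (cd_add a b) (cd_add c d) = cd_add (cd_add a c) (cd_add b d)"
  by (induction n arbitrary: a b c d) auto

text \<open>
  This is \<open>b (a + a\<^sup>*) = 2 Re(a) b\<close>; in this form the induction needs no distributivity of the product.
\<close>

lemma cd_mult_add_mult_conj:
  "a \<in> cd_carrier n \<Longrightarrow> b \<in> cd_carrier n \<Longrightarrow>
   cd_add (cd_mult b a) (cd_mult b (cd_conj a)) = cd_scale (2 * cd_re a) b"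
proof (induction n arbitrary: a b)
  case 0
  then show ?case by auto
next
  case (Suc n)
  then obtain a1 a2 b1 b2 where a: "a = Pair a1 a2" and b: "b = Pair b1 b2"
    and C: "a1 \<in> cd_carrier n" "a2 \<in> cd_carrier n" "b1 \<in> cd_carrier n" "b2 \<in> cd_carrier n"
    by auto
  \<comment> \<open>In the second component the product with \<open>cd_conj a1\<close> stems from
    \<open>b a\<close> and the one with \<open>a1\<close> from the conjugate term, so the induction
    hypothesis is needed with its summands swapped.\<close>
  have 1: "cd_add (cd_mult b2 (cd_conj a1)) (cd_mult b2 a1) = cd_scale (2 * cd_re a1) b2"
    using Suc.IH[OF C(1,4)] C by (simp add: cd_add_commute[of _ n])
  \<comment> \<open>After regrouping, the products involving \<open>a2\<close> occur in each
    component with opposite signs and cancel; what remains is the induction hypothesis for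
    \<open>b1\<close> and for \<open>b2\<close>.\<close>
  show ?case
    using C 1 Suc.IH[OF C(1,3)]
    by (simp add: a b cd_minus_def cd_mult_uminus[of _ n]
        cd_add_add_eq[of "cd_mult b1 a1" n]
        cd_add_add_eq[of "cd_mult a2 b1" n "cd_mult b2 (cd_conj a1)" "cd_uminus (cd_mult a2 b1)"]
        cd_add_uminus[of _ n] cd_uminus_add[of _ n])
qed

lemma cd_scale_add_scale:
  "a \<in> cd_carrier n \<Longrightarrow> cd_add (cd_scale r a) (cd_scale s a) = cd_scale (r + s) a"
  by (induction n arbitrary: a) (auto simp: algebra_simps)

text \<open>In the product of \<open>Pair (cd_conj a1) (cd_uminus a2)\<close> with
  \<open>Pair a1 a2\<close>, the first component is the sum of the two smaller instances, and the
  second is \<open>cd_mult a2 (cd_conj a1)\<close> minus itself.\<close>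

lemma cd_conj_mult_self:
  "a \<in> cd_carrier n \<Longrightarrow> cd_mult (cd_conj a) a = cd_scale (cd_normsq a) (cd_one n)"
proof (induction n arbitrary: a)
  case 0
  then show ?case by (auto simp: power2_eq_square)
next
  case (Suc n)
  then show ?case
    by (auto simp: cd_minus_def cd_mult_uminus[of _ n] cd_scale_add_scale[of _ n]
        cd_add_uminus[of _ n])
qed

lemma cd_add_minus_scale:
  "a \<in> cd_carrier n \<Longrightarrow> u \<in> cd_carrier n \<Longrightarrow>
   cd_minus (cd_add a (cd_scale r u)) (cd_scale s u) = cd_add a (cd_scale (r - s) u)"
  by (induction n arbitrary: a u) (auto simp: cd_minus_def cd_uminus_def algebra_simps)

text \<open>For \<open>Pair a1 a2\<close>, the first component of the square is the square of
  \<open>a1\<close> minus \<open>cd_mult (cd_conj a2) a2\<close>, a multiple of the unit by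
  \<open>cd_conj_mult_self\<close>; the second is covered by
  \<open>cd_mult_add_mult_conj\<close>.\<close>

lemma cd_square:
  "a \<in> cd_carrier n \<Longrightarrow>
   cd_mult a a = cd_add (cd_scale (2 * cd_re a) a) (cd_scale (- cd_normsq a) (cd_one n))"
proof (induction n arbitrary: a)
  case 0
  then show ?case by (auto simp: power2_eq_square)
next
  case (Suc n)
  then show ?case
    by (auto simp: cd_mult_add_mult_conj[of _ n] cd_conj_mult_self[of _ n]
        cd_add_minus_scale[of _ n])
qed

section \<open>Linear independence of the unit and a non-scalar element\<close>

lemma cd_scale_eq_zero:
  assumes "cd_scale r a = cd_zero n"
  shows "r = 0 \<or> a = cd_zero n"
proof (cases "r = 0")
  case False
  then have "a = cd_scale (1 / r) (cd_scale r a)" by simp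
  with assms show ?thesis by simp
qed simp

lemma cd_one_neq_zero: "cd_one n \<noteq> cd_zero n"
  by (induction n) auto

text \<open>The unit has second component zero, so the relation forces \<open>y\<close> times the
  second half of \<open>a\<close> to vanish; the first half is scalar by induction.\<close>

lemma cd_dependent_imp_scalar:
  "a \<in> cd_carrier n \<Longrightarrow> cd_add (cd_scale x (cd_one n)) (cd_scale y a) = cd_zero n \<Longrightarrow>
   y \<noteq> 0 \<Longrightarrow> a = cd_scale (- x / y) (cd_one n)"
proof (induction n arbitrary: a)
  case 0
  then show ?case by (auto simp: field_simps)
next
  case (Suc n)
  then show ?case using cd_scale_eq_zero[of y _ n] by auto
qed

lemma cd_scale_0: "a \<in> cd_carrier n \<Longrightarrow> cd_scale 0 a = cd_zero n"
  by (induction n arbitrary: a) auto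

lemma cd_independent:
  assumes "a \<in> cd_carrier n" "\<nexists>r. a = cd_scale r (cd_one n)"
    and "cd_add (cd_scale x (cd_one n)) (cd_scale y a) = cd_zero n"
  shows "x = 0" "y = 0"
proof -
  show y: "y = 0" using cd_dependent_imp_scalar assms by blast
  show "x = 0"
    using assms cd_scale_eq_zero[of x "cd_one n" n] cd_one_neq_zero
    by (simp add: y cd_scale_0[of _ n])
qed

section \<open>Squared norm, real part and coordinates\<close>

lemma cd_normsq_nonneg: "0 \<le> cd_normsq a"
  by (induction a) auto

text \<open>Makes the discriminant of X^2 - 2 Re(a) X + |a|^2 nonpositive.\<close>

lemma cd_re_le_normsq: "(cd_re a)\<^sup>2 \<le> cd_normsq a"
  by (induction a) (auto intro: add_increasing2 cd_normsq_nonneg)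

lemma cd_normsq_zero [simp]: "cd_normsq (cd_zero n) = 0"
  by (induction n) auto

lemma cd_normsq_scale_one [simp]: "cd_normsq (cd_scale r (cd_one n)) = r\<^sup>2"
  by (induction n) auto

lemma length_cd_coords: "a \<in> cd_carrier n \<Longrightarrow> length (cd_coords a) = 2 ^ n"
  by (induction n arbitrary: a) auto

lemma cd_normsq_coords:
  assumes "a \<in> cd_carrier n"
  shows "(\<Sum>j<2 ^ n. (cd_coords a ! j)\<^sup>2) = cd_normsq a"
proof -
  \<comment> \<open>Coordinate lists are concatenated exactly as squared norms are added; the
    carrier then supplies the length, hence the index range.\<close>
  have "sum_list (map power2 (cd_coords a)) = cd_normsq a" by (induction a) auto
  with length_cd_coords[OF assms] show ?thesis
    by (simp add: sum_list_sum_nth atLeast0LessThan)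
qed

section \<open>Evaluating polynomials of degree 1 and 2\<close>

lemma cayley_dickson_simps [simp]:
  "carrier (cayley_dickson n) = cd_carrier n" "mult (cayley_dickson n) = cd_mult"
  "one (cayley_dickson n) = cd_one n" "zero (cayley_dickson n) = cd_zero n"
  "add (cayley_dickson n) = cd_add" "smult (cayley_dickson n) = cd_scale"
  by (simp_all add: cayley_dickson_def)

lemma abelian_monoid_cayley_dickson: "abelian_monoid (cayley_dickson n)"
  by (rule abelian_monoidI) (auto simp: cd_add_assoc[of _ n] intro: cd_add_commute)

lemma cayley_dickson_pow_simps:
  "a [^]\<^bsub>cayley_dickson n\<^esub> (0::nat) = cd_one n"
  "a [^]\<^bsub>cayley_dickson n\<^esub> Suc i = cd_mult (a [^]\<^bsub>cayley_dickson n\<^esub> i) a"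
  by (simp_all add: nat_pow_def)

lemma cayley_dickson_pow_closed:
  "a \<in> cd_carrier n \<Longrightarrow> a [^]\<^bsub>cayley_dickson n\<^esub> (i::nat) \<in> cd_carrier n"
  by (induction i) (auto simp: cayley_dickson_pow_simps)

lemma alg_poly_linear:
  assumes "a \<in> cd_carrier n"
  shows "alg_poly (cayley_dickson n) [:c, 1:] a = cd_add (cd_scale c (cd_one n)) (cd_scale 1 a)"
proof -
  interpret abelian_monoid "cayley_dickson n" by (rule abelian_monoid_cayley_dickson)
  show ?thesis
    using assms finsum_Suc[of "\<lambda>i. cd_scale (coeff [:c, 1:] i) (a [^]\<^bsub>cayley_dickson n\<^esub> i)" 0]
    by (simp add: alg_poly_def Pi_iff cayley_dickson_pow_closed finsum_0 cayley_dickson_pow_simps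
        cd_mult_one cd_add_commute[of _ n])
qed

text \<open>Brings a value to the form x 1 + y a, to which independence applies, once
  \<open>cd_square\<close> has replaced the square.\<close>

lemma cd_quadratic_collect:
  "a \<in> cd_carrier n \<Longrightarrow> u \<in> cd_carrier n \<Longrightarrow>
   cd_add (cd_add (cd_scale s a) (cd_scale t u)) (cd_add (cd_scale y a) (cd_scale x u)) =
   cd_add (cd_scale (x + t) u) (cd_scale (y + s) a)"
  by (induction n arbitrary: a u) (auto simp: algebra_simps)

lemma alg_poly_quadratic:
  assumes "a \<in> cd_carrier n"
  shows "alg_poly (cayley_dickson n) [:c, d, 1:] a =
    cd_add (cd_scale (c - cd_normsq a) (cd_one n)) (cd_scale (d + 2 * cd_re a) a)"
proof -
  interpret abelian_monoid "cayley_dickson n" by (rule abelian_monoid_cayley_dickson)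
  let ?f = "\<lambda>i. cd_scale (coeff [:c, d, 1:] i) (a [^]\<^bsub>cayley_dickson n\<^esub> i)"
  have "alg_poly (cayley_dickson n) [:c, d, 1:] a =
    cd_add (cd_mult a a) (cd_add (cd_scale d a) (cd_scale c (cd_one n)))"
    \<comment> \<open>Peels the sum from the top, which explains why the square stands
      first.\<close>
    using assms finsum_Suc[of ?f 0] finsum_Suc[of ?f "Suc 0"]
    by (simp add: alg_poly_def Pi_iff cayley_dickson_pow_closed finsum_0 cayley_dickson_pow_simps cd_mult_one)
  with assms show ?thesis
    by (simp add: cd_square[OF assms] cd_quadratic_collect[of _ n])
qed

section \<open>Minimal polynomials\<close>

lemma monic_degree_1E:
  assumes "degree p = 1" "lead_coeff p = (1::real)"
  obtains c where "p = [:c, 1:]"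
proof -
  from assms(1) obtain c d where "p = [:c, d:]" by (rule degree1_coeffs)
  with assms that show thesis by auto
qed

lemma monic_degree_2E:
  assumes "degree p = 2" "lead_coeff p = (1::real)"
  obtains c d where "p = [:c, d, 1:]"
proof -
  from assms(1) obtain c d e where "p = [:c, d, e:]" by (rule degree2_coeffs)
  with assms that show thesis by (auto simp: numeral_2_eq_2)
qed

text \<open>Any two minimal polynomials have equal degree, so uniqueness only has to be checked
  among annihilators of the degree of \<open>q\<close>.\<close>

lemma minimal_poly_eqI:
  assumes "is_minimal_poly A a q"
    and "\<And>p. monic_annihilator A a p \<Longrightarrow> degree p = degree q \<Longrightarrow> p = q"
  shows "minimal_poly A a = q"
  unfolding minimal_poly_def
  using assms by (intro the_equality) (auto simp: is_minimal_poly_def intro: order_antisym)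

lemma minimal_poly_scalar:
  "minimal_poly (cayley_dickson n) (cd_scale r (cd_one n)) = [:- r, 1:]"
proof (rule minimal_poly_eqI)
  let ?a = "cd_scale r (cd_one n)"
  have ev: "alg_poly (cayley_dickson n) [:c, 1:] ?a = cd_scale (c + r) (cd_one n)" for c
    by (simp add: alg_poly_linear cd_scale_add_scale[of _ n])
  \<comment> \<open>Minimality is immediate, since monic annihilators have positive degree.\<close>
  show "is_minimal_poly (cayley_dickson n) ?a [:- r, 1:]"
    by (auto simp: is_minimal_poly_def monic_annihilator_def ev cd_scale_0[of _ n])
  fix p assume p: "monic_annihilator (cayley_dickson n) ?a p" "degree p = degree [:- r, 1:]"
  then obtain c where c: "p = [:c, 1:]"
    using monic_degree_1E[of p] by (auto simp: monic_annihilator_def)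
  with p have "cd_scale (c + r) (cd_one n) = cd_zero n"
    by (simp add: monic_annihilator_def ev)
  then have "c + r = 0"
    using cd_scale_eq_zero[of _ "cd_one n" n] cd_one_neq_zero by blast
  then show "p = [:- r, 1:]" by (simp add: c eq_neg_iff_add_eq_0)
qed

lemma minimal_poly_nonscalar:
  assumes a: "a \<in> cd_carrier n" "\<nexists>r. a = cd_scale r (cd_one n)"
  shows "minimal_poly (cayley_dickson n) a = [:cd_normsq a, - 2 * cd_re a, 1:]" (is "_ = ?q")
proof (rule minimal_poly_eqI)
  have "degree p \<noteq> 1" if p: "monic_annihilator (cayley_dickson n) a p" for p
  proof
    assume "degree p = 1"
    with p obtain c where "p = [:c, 1:]"
      using monic_degree_1E[of p] by (auto simp: monic_annihilator_def)
    \<comment> \<open>The coefficient 1 of \<open>a\<close> is written out so that independence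
      yields the contradiction 1 = 0.\<close>
    with p have "cd_add (cd_scale c (cd_one n)) (cd_scale 1 a) = cd_zero n"
      by (simp add: monic_annihilator_def alg_poly_linear[OF a(1)])
    from cd_independent(2)[OF a this] show False by simp
  qed
  moreover have "0 < degree p" if "monic_annihilator (cayley_dickson n) a p" for p
    using that by (simp add: monic_annihilator_def)
  ultimately have "2 \<le> degree p" if "monic_annihilator (cayley_dickson n) a p" for p
    using that by (metis One_nat_def Suc_1 Suc_leI le_neq_implies_less)
  then show "is_minimal_poly (cayley_dickson n) a ?q"
    using a by (auto simp: is_minimal_poly_def monic_annihilator_def alg_poly_quadratic
        cd_scale_0[of _ n] numeral_2_eq_2)
  fix p assume p: "monic_annihilator (cayley_dickson n) a p" "degree p = degree ?q"
  then obtain c d where cd: "p = [:c, d, 1:]"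
    using monic_degree_2E[of p] by (auto simp: monic_annihilator_def numeral_2_eq_2)
  with p have "cd_add (cd_scale (c - cd_normsq a) (cd_one n)) (cd_scale (d + 2 * cd_re a) a)
      = cd_zero n"
    by (simp add: monic_annihilator_def alg_poly_quadratic[OF a(1)])
  \<comment> \<open>Both coefficients vanish, which determines \<open>c\<close> and
    \<open>d\<close>.\<close>
  from cd_independent[OF a this] show "p = ?q" by (simp add: cd eq_neg_iff_add_eq_0)
qed

section \<open>Moduli of the roots, and the radius\<close>

lemma norms_of_roots_of_quadratic:
  fixes r N :: real
  assumes "r\<^sup>2 \<le> N"
  shows "{cmod z |z. poly (map_poly complex_of_real [:N, - 2 * r, 1:]) z = 0} = {sqrt N}"
proof -
  \<comment> \<open>Real and imaginary parts of the equation, the latter divided by 2.\<close>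
  have root: "poly (map_poly complex_of_real [:N, - 2 * r, 1:]) z = 0 \<longleftrightarrow>
      (Re z)\<^sup>2 - (Im z)\<^sup>2 - 2 * r * Re z + N = 0 \<and> (Re z - r) * Im z = 0" for z
    by (auto simp: map_poly_pCons complex_eq_iff algebra_simps power2_eq_square)
  have "cmod z = sqrt N" if "poly (map_poly complex_of_real [:N, - 2 * r, 1:]) z = 0" for z
  proof -
    from that have *: "(Re z)\<^sup>2 - (Im z)\<^sup>2 - 2 * r * Re z + N = 0" "Re z = r \<or> Im z = 0"
      unfolding root by auto
    have "(Re z - r)\<^sup>2 = (Im z)\<^sup>2 + r\<^sup>2 - N"
      using *(1) by (simp add: power2_eq_square algebra_simps)
    \<comment> \<open>If Im z = 0, the square equals \<open>r\<^sup>2 - N\<close>, which is at most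
      0, so it vanishes.\<close>
    then have "Re z = r"
      using *(2) assms zero_le_power2[of "Re z - r"] by auto
    with *(1) show ?thesis by (simp add: cmod_def power2_eq_square)
  qed
  \<comment> \<open>An explicit root, so that the set of moduli is not empty.\<close>
  moreover have "poly (map_poly complex_of_real [:N, - 2 * r, 1:]) (Complex r (sqrt (N - r\<^sup>2))) = 0"
    unfolding root using assms by (simp add: power2_eq_square)
  ultimately show ?thesis by (auto intro!: exI[of _ "Complex r (sqrt (N - r\<^sup>2))"])
qed

theorem theorem2p3:
  fixes n :: nat and a :: cd
  assumes "a \<in> carrier (cayley_dickson n)"
  shows "radius (cayley_dickson n) a = sqrt (\<Sum>j<2 ^ n. (cd_coords a ! j)\<^sup>2)"
proof -
  from assms have a: "a \<in> cd_carrier n" by simp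
  have "radius (cayley_dickson n) a = sqrt (cd_normsq a)"
  proof (cases "\<exists>r. a = cd_scale r (cd_one n)")
    case True
    then obtain r where r: "a = cd_scale r (cd_one n)" ..
    \<comment> \<open>The only root is \<open>r\<close>; its modulus agrees with the norm because
      the squared norm of \<open>r\<close> times the unit is \<open>r\<^sup>2\<close>.\<close>
    have "{cmod z |z. poly (map_poly complex_of_real [:- r, 1:]) z = 0} = {\<bar>r\<bar>}"
      by (auto simp: map_poly_pCons add_eq_0_iff intro: exI[of _ "complex_of_real r"])
    then show ?thesis by (simp add: radius_def r minimal_poly_scalar)
  next
    case False
    then show ?thesis
      unfolding radius_def minimal_poly_nonscalar[OF a False]
        norms_of_roots_of_quadratic[OF cd_re_le_normsq] by simp
  qed
  then show ?thesis by (simp add: cd_normsq_coords[OF a])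
qed

end
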